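(* (I) Let $\ell,n$ be integers such that $2\leq \ell\leq n$, and let $p_1,\ldots,p_\ell\in \mathbb{R}^n$ be in general position. Then $D_{(p_1,\ldots,p_\ell)} : \mathbb{R}^n\rightarrow \mathbb{R}^\ell$ is $\mathcal{A}$-equivalent to the normal form of definite fold mappings, i.e. to the mapping $(x_1,\ldots,x_n)\mapsto(x_1,\ldots,x_{\ell-1},x_\ell^2+\cdots+x_n^2)$. (II) Let $\ell,n$ be integers such that $1\leq n<\ell$, and let $p_1,\ldots,p_\ell\in\mathbb{R}^n$ be points such that $p_1,\ldots,p_{n+1}$ are in general position. Then $D_{(p_1,\ldots,p_\ell)} : \mathbb{R}^n\rightarrow \mathbb{R}^\ell$ is $\mathcal{A}$-equivalent to the inclusion $(x_1,\ldots,x_n)\mapsto (x_1,\ldots,x_n,0,\ldots,0)$.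
   Context: All mappings are of class $C^\infty$. $d(x,y)=\sqrt{\sum_{j=1}^n(x_j-y_j)^2}$ is the Euclidean distance on $\mathbb{R}^n$. For points $p_1,\ldots,p_\ell\in\mathbb{R}^n$ ($\ell\ge1$), the distance-squared mapping $D_{(p_1,\ldots,p_\ell)}:\mathbb{R}^n\to\mathbb{R}^\ell$ is defined by $D_{(p_1,\ldots,p_\ell)}(x)=(d^2(p_1,x),\ldots,d^2(p_\ell,x))$, where $d^2(p,x)=d(p,x)^2$. Points $p_1,\ldots,p_k\in\mathbb{R}^n$ $(1\le k\le n+1)$ are in general position if $k=1$ or the vectors $\overrightarrow{p_1p_2},\ldots,\overrightarrow{p_1p_k}$ ($2\le k\le n+1$) are linearly independent. A mapping $f:\mathbb{R}^n\to\mathbb{R}^\ell$ is $\mathcal{A}$-equivalent to $g:\mathbb{R}^n\to\mathbb{R}^\ell$ if there exist diffeomorphisms $\varphi:\mathbb{R}^n\to\mathbb{R}^n$ and $\psi:\mathbb{R}^\ell\to\mathbb{R}^\ell$ such that $\psi\circ f\circ\varphi^{-1}=g$. *)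

theory Defs
  imports "HOL-Analysis.Analysis"
begin

(* R^n is real^'n with 'n :: {finite, linorder}; the linear order on the index type says
   which component is the k-th coordinate.  Every n >= 1 is CARD('n) for such a type. *)

definition index_pos :: "'n::{finite,linorder} \<Rightarrow> nat"
  where "index_pos i = card {..i}"

definition coord :: "real^'n::{finite,linorder} \<Rightarrow> nat \<Rightarrow> real"
  where "coord x k = x $ the_inv_into UNIV index_pos k"

lemma index_pos_strict_mono: "strict_mono (index_pos :: 'n::{finite,linorder} \<Rightarrow> nat)"
  unfolding index_pos_def by (intro strict_monoI psubset_card_mono) auto

lemma inj_index_pos: "inj (index_pos :: 'n::{finite,linorder} \<Rightarrow> nat)"
  using index_pos_strict_mono by (rule strict_mono_imp_inj_on)

lemma bij_betw_index_pos:
  "bij_betw (index_pos :: 'n::{finite,linorder} \<Rightarrow> nat) UNIV {1..CARD('n)}"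
proof -
  have "range (index_pos :: 'n \<Rightarrow> nat) \<subseteq> {1..CARD('n)}"
    by (auto simp: index_pos_def Suc_le_eq card_gt_0_iff intro!: card_mono)
  moreover have "card (range (index_pos :: 'n \<Rightarrow> nat)) = card {1..CARD('n)}"
    by (simp add: card_image inj_index_pos)
  ultimately have "range (index_pos :: 'n \<Rightarrow> nat) = {1..CARD('n)}"
    by (intro card_subset_eq) auto
  then show ?thesis
    by (simp add: bij_betw_def inj_index_pos)
qed

lemma coord_index_pos: "coord x (index_pos i) = x $ i"
  by (simp add: coord_def the_inv_into_f_f inj_index_pos)

(* In finite dimension, f is C^(k+1) iff it is differentiable and all its directional
   derivatives x \<mapsto> Df(x) v are C^k. *)

primrec C_k :: "nat \<Rightarrow> ('a::euclidean_space \<Rightarrow> 'b::euclidean_space) \<Rightarrow> bool"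
  where
    "C_k 0 f \<longleftrightarrow> continuous_on UNIV f"
  | "C_k (Suc k) f \<longleftrightarrow>
       (\<forall>x. f differentiable (at x)) \<and> (\<forall>v. C_k k (\<lambda>x. frechet_derivative f (at x) v))"

definition smooth :: "('a::euclidean_space \<Rightarrow> 'b::euclidean_space) \<Rightarrow> bool"
  where "smooth f \<longleftrightarrow> (\<forall>k. C_k k f)"

definition diffeomorphism :: "('a::euclidean_space \<Rightarrow> 'b::euclidean_space) \<Rightarrow> bool"
  where "diffeomorphism f \<longleftrightarrow> bij f \<and> smooth f \<and> smooth (inv f)"

definition A_equivalent ::
    "('a::euclidean_space \<Rightarrow> 'b::euclidean_space) \<Rightarrow> ('a \<Rightarrow> 'b) \<Rightarrow> bool"
  where "A_equivalent f g \<longleftrightarrow>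
    (\<exists>(\<phi> :: 'a \<Rightarrow> 'a) (\<psi> :: 'b \<Rightarrow> 'b).
       diffeomorphism \<phi> \<and> diffeomorphism \<psi> \<and> \<psi> \<circ> f \<circ> inv \<phi> = g)"

(* Concerns p 1, ..., p k only.  The library's independent is a predicate on sets, so
   injectivity is needed to express linear independence of the family. *)

definition general_position :: "nat \<Rightarrow> (nat \<Rightarrow> 'a::euclidean_space) \<Rightarrow> bool"
  where "general_position k p \<longleftrightarrow>
    k = 1 \<or>
    2 \<le> k \<and> inj_on (\<lambda>j. p j - p 1) {2..k} \<and> independent ((\<lambda>j. p j - p 1) ` {2..k})"

(* Only p 1, ..., p CARD('l) are used. *)

definition distance_squared ::
    "(nat \<Rightarrow> real^'n) \<Rightarrow> real^'n \<Rightarrow> real^'l::{finite,linorder}"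
  where "distance_squared p x = (\<chi> i. (dist (p (index_pos i)) x)\<^sup>2)"

definition definite_fold :: "real^'n::{finite,linorder} \<Rightarrow> real^'l::{finite,linorder}"
  where "definite_fold x =
    (\<chi> i. if index_pos i < CARD('l) then coord x (index_pos i)
         else (\<Sum>k = CARD('l)..CARD('n). (coord x k)\<^sup>2))"

definition inclusion :: "real^'n::{finite,linorder} \<Rightarrow> real^'l::{finite,linorder}"
  where "inclusion x = (\<chi> i. if index_pos i \<le> CARD('n) then coord x (index_pos i) else 0)"

end

theory Submission imports Defs begin

text \<open>
  Put \<open>v k = p (k + 1) - p 1\<close> and move the origin to \<open>p 1\<close> by \<open>u = x - p 1\<close>. The components of the
  distance-squared map are then \<open>u \<bullet> u\<close> and \<open>u \<bullet> u - 2 * (v k \<bullet> u) + v k \<bullet> v k\<close>. Their quadratic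
  parts agree, so an affine automorphism \<open>\<alpha>\<close> of the target, built from differences of components
  (\<open>diffeomorphism_distance_differences\<close>), turns the map into
  \<open>(v 1 \<bullet> u, \<dots>, v (l - 1) \<bullet> u, u \<bullet> u)\<close>, where \<open>n\<close> and \<open>l\<close> are the dimensions of source and target.

  Let \<open>m = min n (l - 1)\<close>. In both parts general position says that \<open>v 1, \<dots>, v m\<close> are linearly
  independent, so the \<open>v k \<bullet> u\<close> with \<open>k \<le> m\<close> can serve as the first \<open>m\<close> coordinates of a linear
  coordinate system of the source. The others are taken orthonormal on the orthogonal complement of
  the span of these vectors (\<open>adapted_coordinates\<close>). The orthogonal projection \<open>u'\<close> of \<open>u\<close> to that span
  is a linear function of the first \<open>m\<close> target coordinates alone. Hence subtracting \<open>u' \<bullet> u'\<close> from the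
  last target coordinate, and \<open>v k \<bullet> u'\<close> from those with \<open>m < k < l\<close>, is a polynomial shear of the
  target and so a diffeomorphism (\<open>diffeomorphism_shear\<close>).

  By the theorem of Pythagoras the last coordinate becomes the square norm of \<open>u - u'\<close>, that is the
  sum of the squares of the source coordinates after the first \<open>m\<close>. If \<open>l \<le> n\<close>, then \<open>m = l - 1\<close> and
  this is the definite fold. If \<open>n < l\<close>, then \<open>m = n\<close>, the \<open>v k\<close> with \<open>k \<le> m\<close> span the source,
  \<open>u = u'\<close>, and all coordinates after the first \<open>n\<close> vanish, which is the inclusion. Both parts are
  therefore instances of one statement, \<open>distance_squared_A_equivalent\<close>.
\<close>

section \<open>Smooth maps and diffeomorphisms\<close>

lemma C_k_SucI:
  assumes "\<And>x. (f has_derivative F x) (at x)" "\<And>v. C_k k (\<lambda>x. F x v)"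
  shows "C_k (Suc k) f"
proof -
  have "frechet_derivative f (at x) = F x" for x
    using assms(1) frechet_derivative_at by metis
  then show ?thesis
    using assms by (auto simp: differentiable_def)
qed

lemma C_k_Suc_has_derivative:
  assumes "C_k (Suc k) f"
  shows "(f has_derivative frechet_derivative f (at x)) (at x)"
  using assms by (simp add: frechet_derivative_works)

lemma C_k_SucD: "C_k (Suc k) f \<Longrightarrow> C_k k f"
proof (induction k arbitrary: f)
  case 0
  then show ?case
    by (auto intro!: continuous_at_imp_continuous_on differentiable_imp_continuous_within)
next
  case (Suc k)
  then show ?case
    by (metis C_k.simps(2))
qed

lemma C_k_const: "C_k k (\<lambda>x. c)"
proof (induction k arbitrary: c)
  case (Suc k)
  show ?case
    by (rule C_k_SucI[where F = "\<lambda>x v. 0"]) (auto intro: Suc)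
qed simp

lemma C_k_linear:
  assumes "bounded_linear L"
  shows "C_k k L"
proof (cases k)
  case 0
  then show ?thesis
    using assms by (simp add: linear_continuous_on)
next
  case (Suc j)
  then show ?thesis
    unfolding Suc using assms
    by (intro C_k_SucI[where F = "\<lambda>x. L"] C_k_const bounded_linear_imp_has_derivative)
qed

lemma C_k_add:
  assumes "C_k k f" "C_k k g"
  shows "C_k k (\<lambda>x. f x + g x)"
  using assms
proof (induction k arbitrary: f g)
  case 0
  then show ?case by (simp add: continuous_on_add)
next
  case (Suc k)
  note [derivative_intros] = Suc.prems[THEN C_k_Suc_has_derivative]
  show ?case
    by (rule C_k_SucI, (rule derivative_intros)+) (use Suc in auto)
qed

lemma C_k_sum:
  assumes "\<And>i. i \<in> I \<Longrightarrow> C_k k (f i)"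
  shows "C_k k (\<lambda>x. \<Sum>i\<in>I. f i x)"
  using assms by (induction I rule: infinite_finite_induct) (auto intro: C_k_const C_k_add)

text \<open>The two summands of the product rule are bilinear images of a function with one derivative
  more than needed and of a derivative, so the induction hypothesis covers both.\<close>

lemma C_k_bilinear:
  assumes B: "bounded_bilinear B" and "C_k k f" "C_k k g"
  shows "C_k k (\<lambda>x. B (f x) (g x))"
  using assms(2,3)
proof (induction k arbitrary: f g)
  case 0
  then show ?case by (simp add: bounded_bilinear.continuous_on[OF B])
next
  case (Suc k)
  show ?case
  proof (rule C_k_SucI)
    show "((\<lambda>x. B (f x) (g x)) has_derivative
        (\<lambda>v. B (f x) (frechet_derivative g (at x) v) + B (frechet_derivative f (at x) v) (g x)))
        (at x)" for x
      by (intro bounded_bilinear.FDERIV[OF B] Suc.prems[THEN C_k_Suc_has_derivative])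
    show "C_k k (\<lambda>x. B (f x) (frechet_derivative g (at x) v)
        + B (frechet_derivative f (at x) v) (g x))" for v
      using Suc.prems[THEN C_k_SucD] Suc.prems by (intro C_k_add Suc.IH) auto
  qed
qed

text \<open>By the chain rule a directional derivative of \<open>g \<circ> f\<close> is \<open>Dg (f x)\<close> applied to a vector
  that varies with \<open>x\<close>. Expanding this vector in the standard basis turns the expression into a
  sum of products of a coordinate of \<open>Df\<close> with a directional derivative of \<open>g\<close> in a fixed
  direction, composed with \<open>f\<close>; only for a fixed direction does the induction hypothesis apply.\<close>

lemma C_k_compose:
  fixes f :: "'a::euclidean_space \<Rightarrow> 'b::euclidean_space" and g :: "'b \<Rightarrow> 'c::euclidean_space"
  assumes "C_k k g" "C_k k f"
  shows "C_k k (\<lambda>x. g (f x))"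
  using assms
proof (induction k arbitrary: g)
  case 0
  then show ?case by (auto intro: continuous_on_compose2)
next
  case (Suc k)
  let ?Df = "\<lambda>x. frechet_derivative f (at x)" and ?Dg = "\<lambda>y. frechet_derivative g (at y)"
  show ?case
  proof (rule C_k_SucI)
    fix x
    have lin: "linear (?Dg (f x))"
      using C_k_Suc_has_derivative[OF Suc.prems(1)] has_derivative_linear by blast
    have expand: "?Dg (f x) w = (\<Sum>b\<in>Basis. (w \<bullet> b) *\<^sub>R ?Dg (f x) b)" for w
    proof -
      have "?Dg (f x) (\<Sum>b\<in>Basis. (w \<bullet> b) *\<^sub>R b) = (\<Sum>b\<in>Basis. (w \<bullet> b) *\<^sub>R ?Dg (f x) b)"
        by (simp add: linear_sum[OF lin] linear_cmul[OF lin])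
      then show ?thesis
        by (simp add: euclidean_representation)
    qed
    have "((\<lambda>x. g (f x)) has_derivative (\<lambda>v. ?Dg (f x) (?Df x v))) (at x)"
      using has_derivative_compose Suc.prems[THEN C_k_Suc_has_derivative] by blast
    then show "((\<lambda>x. g (f x)) has_derivative
        (\<lambda>v. \<Sum>b\<in>Basis. (?Df x v \<bullet> b) *\<^sub>R ?Dg (f x) b)) (at x)"
      by (simp only: expand[symmetric])
  next
    fix v
    show "C_k k (\<lambda>x. \<Sum>b\<in>Basis. (?Df x v \<bullet> b) *\<^sub>R ?Dg (f x) b)"
    proof (intro C_k_sum C_k_bilinear[OF bounded_bilinear_scaleR])
      show "C_k k (\<lambda>x. ?Df x v \<bullet> b)" for b
        using Suc.prems by (intro C_k_bilinear[OF bounded_bilinear_inner] C_k_const) auto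
      show "C_k k (\<lambda>x. ?Dg (f x) b)" for b
        using Suc.prems C_k_SucD[OF Suc.prems(2)] by (intro Suc.IH) auto
    qed
  qed
qed

lemma smooth_const: "smooth (\<lambda>x. c)"
  and smooth_linear: "bounded_linear L \<Longrightarrow> smooth L"
  and smooth_add: "smooth f \<Longrightarrow> smooth g \<Longrightarrow> smooth (\<lambda>x. f x + g x)"
  and smooth_sum: "(\<And>i. i \<in> I \<Longrightarrow> smooth (F i)) \<Longrightarrow> smooth (\<lambda>x. \<Sum>i\<in>I. F i x)"
  and smooth_inner: "smooth f \<Longrightarrow> smooth g \<Longrightarrow> smooth (\<lambda>x. f x \<bullet> g x)"
  and smooth_scaleR: "smooth r \<Longrightarrow> smooth g \<Longrightarrow> smooth (\<lambda>x. r x *\<^sub>R g x)"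
  and smooth_compose: "smooth h \<Longrightarrow> smooth f \<Longrightarrow> smooth (\<lambda>x. h (f x))"
  by (auto simp: smooth_def intro: C_k_const C_k_linear C_k_add C_k_sum C_k_compose
      C_k_bilinear[OF bounded_bilinear_inner] C_k_bilinear[OF bounded_bilinear_scaleR])

lemma smooth_ident: "smooth (\<lambda>x. x)"
  by (intro smooth_linear bounded_linear_ident)

lemma smooth_if:
  "(P \<Longrightarrow> smooth f) \<Longrightarrow> (\<not> P \<Longrightarrow> smooth g) \<Longrightarrow> smooth (\<lambda>x. if P then f x else g x)"
  by (cases P) simp_all

lemma smooth_diff:
  assumes "smooth f" "smooth g"
  shows "smooth (\<lambda>x. f x - g x)"
  using smooth_add[OF assms(1) smooth_compose[OF smooth_linear assms(2), of uminus]]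
  by (simp add: bounded_linear_minus bounded_linear_ident)

lemma diffeomorphismI:
  assumes "smooth f" "smooth g" "\<And>x. g (f x) = x" "\<And>y. f (g y) = y"
  shows "diffeomorphism f"
proof -
  have "inv f = g"
    using assms(3,4) by (intro inv_equality) auto
  moreover have "bij f"
    using assms(3,4) by (metis bijI')
  ultimately show ?thesis
    using assms by (simp add: diffeomorphism_def)
qed

lemma diffeomorphism_compose:
  assumes "diffeomorphism f" "diffeomorphism g"
  shows "diffeomorphism (\<lambda>x. g (f x))"
proof (rule diffeomorphismI)
  show "smooth (\<lambda>x. g (f x))" "smooth (\<lambda>y. inv f (inv g y))"
    using assms by (auto simp: diffeomorphism_def intro: smooth_compose)
  show "inv f (inv g (g (f x))) = x" "g (f (inv f (inv g y))) = y" for x y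
    using assms by (auto simp: diffeomorphism_def bij_is_inj bij_is_surj surj_f_inv_f)
qed

text \<open>A shear moves a point by a vector that does not change along the motion, so it is undone by
  moving back by the same vector.\<close>

lemma diffeomorphism_shear:
  assumes "smooth h" "\<And>w. h (w + h w) = h w" "\<And>w. h (w - h w) = h w"
  shows "diffeomorphism (\<lambda>w. w - h w)"
  by (rule diffeomorphismI[where g = "\<lambda>w. w + h w"])
    (use assms in \<open>auto intro: smooth_add smooth_diff smooth_ident\<close>)

lemma A_equivalentI:
  assumes "diffeomorphism \<phi>" "diffeomorphism \<psi>" "\<And>x. \<psi> (f x) = g (\<phi> x)"
  shows "A_equivalent f g"
proof -
  have "\<phi> (inv \<phi> y) = y" for y
    using assms(1) by (simp add: diffeomorphism_def bij_is_surj surj_f_inv_f)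
  then have "\<psi> \<circ> f \<circ> inv \<phi> = g"
    by (auto simp: assms(3))
  then show ?thesis
    using assms(1,2) unfolding A_equivalent_def by blast
qed

section \<open>Vectors given by their coordinates\<close>

definition of_coords :: "(nat \<Rightarrow> real) \<Rightarrow> real^'n::{finite,linorder}"
  where "of_coords c = (\<chi> i. c (index_pos i))"

lemma index_pos_surj:
  "k \<in> {1..CARD('n::{finite,linorder})} \<Longrightarrow> \<exists>i :: 'n. k = index_pos i"
  using bij_betw_index_pos[where 'n = 'n] by (auto simp: bij_betw_def)

lemma coord_of_coords:
  "k \<in> {1..CARD('n::{finite,linorder})} \<Longrightarrow> coord (of_coords c :: (real, 'n) vec) k = c k"
  by (metis coord_index_pos index_pos_surj of_coords_def vec_lambda_beta)

lemma index_pos_range: "index_pos (i :: 'n::{finite,linorder}) \<in> {1..CARD('n)}"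
  using bij_betw_index_pos by (metis bij_betwE UNIV_I)

lemma vec_eq_coordI:
  fixes x y :: "real^'n::{finite,linorder}"
  assumes "\<And>k. k \<in> {1..CARD('n)} \<Longrightarrow> coord x k = coord y k"
  shows "x = y"
  by (metis assms coord_index_pos index_pos_range vec_eq_iff)

lemma coord_add: "coord (x + y) k = coord x k + coord y k"
  and coord_diff: "coord (x - y) k = coord x k - coord y k"
  by (simp_all add: coord_def)

lemma smooth_coord: "smooth (\<lambda>x. coord x k)"
  unfolding coord_def by (intro smooth_linear bounded_linear_vec_nth)

lemma smooth_of_coords:
  assumes "\<And>k. smooth (\<lambda>x. c x k)"
  shows "smooth (\<lambda>x. of_coords (c x) :: real^'n::{finite,linorder})"
proof -
  have "of_coords (c x) = (\<Sum>i\<in>UNIV. c x (index_pos i) *\<^sub>R axis i 1 :: (real, 'n) vec)" for x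
    by (subst basis_expansion[symmetric]) (simp add: of_coords_def scalar_mult_eq_scaleR)
  then show ?thesis
    using assms by (auto intro!: smooth_sum smooth_scaleR smooth_const)
qed

section \<open>Coordinates adapted to independent vectors\<close>

text \<open>The remaining coordinates are taken with respect to an orthonormal basis of the orthogonal
  complement of the span of the \<open>v k\<close>. On this complement they compute the scalar product, which
  is all that is used of them below.\<close>

lemma adapted_coordinates:
  fixes v :: "nat \<Rightarrow> real^'n::{finite,linorder}"
  assumes inj: "inj_on v {1..m}" and indep: "independent (v ` {1..m})"
  obtains A :: "(real, 'n) vec \<Rightarrow> (real, 'n) vec" where "linear A" "bij A"
    "\<And>x k. k \<in> {1..m} \<Longrightarrow> coord (A x) k = v k \<bullet> x"
    "\<And>x y. \<forall>k\<in>{1..m}. v k \<bullet> x = 0 \<Longrightarrow>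
      x \<bullet> y = (\<Sum>k = m + 1..CARD('n). coord (A x) k * coord (A y) k)"
proof -
  define V where "V = span (v ` {1..m})"
  define U where "U = {x. \<forall>y\<in>V. orthogonal y x}"
  have dimV: "dim V = m"
    using inj indep by (simp add: V_def dim_eq_card_independent card_image)
  have dimU: "dim U + m = CARD('n)"
    using dim_subspace_orthogonal_to_vectors[of V UNIV] dimV by (simp add: U_def V_def)
  have "subspace U"
    unfolding U_def by (rule subspace_orthogonal_to_vectors)
  then obtain E where E: "E \<subseteq> U" "pairwise orthogonal E" "\<And>x. x \<in> E \<Longrightarrow> norm x = 1"
      "independent E" "card E = dim U" "span E = U"
    using orthonormal_basis_subspace by metis
  have finE: "finite E"
    using E(4) independent_imp_finite by blast
  have "card {m + 1..CARD('n)} = card E"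
    using E(5) dimU by simp
  then obtain e where e: "bij_betw e {m + 1..CARD('n)} E"
    using finite_same_card_bij[of "{m + 1..CARD('n)}" E] finE by blast
  have U_I: "x \<in> U" if "\<forall>k\<in>{1..m}. v k \<bullet> x = 0" for x
  proof -
    have "orthogonal x y" if "y \<in> V" for y
      by (rule orthogonal_to_span[OF that[unfolded V_def]])
        (use \<open>\<forall>k\<in>{1..m}. v k \<bullet> x = 0\<close> in \<open>auto simp: orthogonal_def inner_commute\<close>)
    then show ?thesis
      by (auto simp: U_def orthogonal_commute)
  qed
  define A :: "(real, 'n) vec \<Rightarrow> (real, 'n) vec"
    where "A x = of_coords (\<lambda>k. (if k \<le> m then v k else e k) \<bullet> x)" for x
  have mn: "m \<le> CARD('n)"
    using dimU by simp
  have A_v: "coord (A x) k = v k \<bullet> x" if "k \<in> {1..m}" for x k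
    using that mn by (simp add: A_def coord_of_coords)
  have A_e: "coord (A x) k = e k \<bullet> x" if "k \<in> {m + 1..CARD('n)}" for x k
    using that by (simp add: A_def coord_of_coords)
  have lin: "linear A"
    by (rule linearI) (auto simp: A_def of_coords_def vec_eq_iff inner_add_right)
  have parseval: "x \<bullet> y = (\<Sum>k = m + 1..CARD('n). coord (A x) k * coord (A y) k)"
    if "\<forall>k\<in>{1..m}. v k \<bullet> x = 0" for x y
  proof -
    have "x = (\<Sum>b\<in>E. (x \<bullet> b) *\<^sub>R b)"
      using orthonormal_basis_expand[OF E(2,3) _ finE] U_I[OF that] E(6) by simp
    then have "x \<bullet> y = (\<Sum>b\<in>E. (x \<bullet> b) *\<^sub>R b) \<bullet> y"
      by simp
    also have "\<dots> = (\<Sum>b\<in>E. (x \<bullet> b) * (b \<bullet> y))"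
      by (simp add: inner_sum_left)
    also have "\<dots> = (\<Sum>k = m + 1..CARD('n). (x \<bullet> e k) * (e k \<bullet> y))"
      by (rule sum.reindex_bij_betw[OF e, symmetric])
    also have "\<dots> = (\<Sum>k = m + 1..CARD('n). coord (A x) k * coord (A y) k)"
      by (rule sum.cong) (auto simp: A_e inner_commute)
    finally show ?thesis .
  qed
  have "x = 0" if "A x = 0" for x
  proof -
    have "coord (A x) k = 0" for k
      using that by (simp add: coord_def)
    then have "x \<bullet> x = 0"
      using A_v[of _ x] by (subst parseval) simp_all
    then show ?thesis by simp
  qed
  then have "inj A"
    using lin by (simp add: linear_injective_0)
  then have "bij A"
    using lin linear_injective_imp_surjective by (auto simp: bij_def)
  then show ?thesis
    using that lin A_v parseval by blast
qed

section \<open>The common normal form\<close>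

text \<open>This is the affine map \<open>\<alpha>\<close>, which is applied with \<open>c k = v k \<bullet> v k\<close>. Its inverse reads
  \<open>coord z 1\<close> off the last coordinate and then solves for the others.\<close>

lemma diffeomorphism_distance_differences:
  fixes c :: "nat \<Rightarrow> real"
  assumes l: "2 \<le> CARD('l::{finite,linorder})"
  shows "diffeomorphism (\<lambda>z :: (real, 'l) vec. of_coords (\<lambda>k.
    if k < CARD('l) then (coord z 1 - coord z (k + 1) + c k) / 2 else coord z 1) :: (real, 'l) vec)"
    (is "diffeomorphism ?\<alpha>")
proof (rule diffeomorphismI)
  let ?\<beta> = "\<lambda>w :: (real, 'l) vec. of_coords (\<lambda>j.
    if j = 1 then coord w CARD('l) else coord w CARD('l) - 2 * coord w (j - 1) + c (j - 1))
    :: (real, 'l) vec"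
  have half: "smooth (\<lambda>x. f x / 2)" if "smooth f" for f :: "(real, 'l) vec \<Rightarrow> real"
    using smooth_scaleR[OF smooth_const[of "1/2"] that] by simp
  have twice: "smooth (\<lambda>x. 2 * f x)" if "smooth f" for f :: "(real, 'l) vec \<Rightarrow> real"
    using smooth_scaleR[OF smooth_const[of 2] that] by simp
  show "smooth ?\<alpha>"
    by (rule smooth_of_coords) (intro smooth_if half smooth_add smooth_diff smooth_coord smooth_const)
  show "smooth ?\<beta>"
    by (rule smooth_of_coords) (intro smooth_if twice smooth_add smooth_diff smooth_coord smooth_const)
  show "?\<beta> (?\<alpha> z) = z" for z
  proof (rule vec_eq_coordI)
    fix k assume k: "k \<in> {1..CARD('l)}"
    then show "coord (?\<beta> (?\<alpha> z)) k = coord z k"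
      using l by (cases k) (auto simp: coord_of_coords field_simps)
  qed
  show "?\<alpha> (?\<beta> w) = w" for w
  proof (rule vec_eq_coordI)
    fix k assume k: "k \<in> {1..CARD('l)}"
    then show "coord (?\<alpha> (?\<beta> w)) k = coord w k"
      using l by (cases "k = CARD('l)") (auto simp: coord_of_coords)
  qed
qed

text \<open>The middle case \<open>m < k < CARD('l)\<close> occurs only for \<open>m = CARD('n)\<close>, where the last coordinate is
  an empty sum. The formula thus covers the definite fold and the inclusion at once.\<close>

lemma distance_squared_A_equivalent:
  fixes p :: "nat \<Rightarrow> real^'n::{finite,linorder}"
  defines "m \<equiv> min CARD('n) (CARD('l::{finite,linorder}) - 1)"
  assumes l: "2 \<le> CARD('l)" and gp: "general_position (m + 1) p"
  shows "A_equivalent (distance_squared p :: (real, 'n) vec \<Rightarrow> (real, 'l) vec)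
    (\<lambda>x. of_coords (\<lambda>k. if k \<le> m then coord x k else if k < CARD('l) then 0
      else \<Sum>j = m + 1..CARD('n). (coord x j)\<^sup>2))"
    (is "A_equivalent _ ?N")
proof -
  define v where "v k = p (k + 1) - p 1" for k
  have m: "1 \<le> m" "m \<le> CARD('n)" "m < CARD('l)"
    using l by (auto simp: m_def Suc_le_eq)
  have shift: "{2..m + 1} = Suc ` {1..m}" "(\<lambda>j. p j - p 1) \<circ> Suc = v"
    by (auto simp: v_def image_Suc_atLeastAtMost)
  have gp': "inj_on (\<lambda>j. p j - p 1) {2..m + 1}" "independent ((\<lambda>j. p j - p 1) ` {2..m + 1})"
    using gp m by (auto simp: general_position_def)
  have "inj_on v {1..m}" "independent (v ` {1..m})"
    using gp' comp_inj_on_iff[of Suc "{1..m}" "\<lambda>j. p j - p 1"]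
    unfolding shift image_comp by simp_all
  then obtain A :: "(real, 'n) vec \<Rightarrow> (real, 'n) vec" where A: "linear A" "bij A"
    "\<And>x k. k \<in> {1..m} \<Longrightarrow> coord (A x) k = v k \<bullet> x"
    and parseval: "\<And>x y. \<forall>k\<in>{1..m}. v k \<bullet> x = 0 \<Longrightarrow>
      x \<bullet> y = (\<Sum>k = m + 1..CARD('n). coord (A x) k * coord (A y) k)"
    by (rule adapted_coordinates) (rule that; fast)
  have lin_inv: "linear (inv A)"
    using A by (intro inj_linear_imp_inv_linear) (auto simp: bij_is_inj)
  have A_inv: "A (inv A y) = y" "inv A (A x) = x" for x y
    using A(2) by (auto simp: bij_is_inj bij_is_surj surj_f_inv_f)
  have smooth_A: "smooth A" "smooth (inv A)"
    using A(1) lin_inv by (auto intro!: smooth_linear simp: linear_conv_bounded_linear)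

  define \<phi> where "\<phi> x = A (x - p 1)" for x
  have \<phi>: "diffeomorphism \<phi>"
  proof (rule diffeomorphismI)
    show "smooth \<phi>" "smooth (\<lambda>y. inv A y + p 1)"
      unfolding \<phi>_def
      by (intro smooth_compose[OF smooth_A(1)] smooth_add smooth_diff smooth_A smooth_ident
          smooth_const)+
  qed (auto simp: \<phi>_def A_inv)

  define \<alpha> :: "(real, 'l) vec \<Rightarrow> (real, 'l) vec" where "\<alpha> z = of_coords (\<lambda>k.
    if k < CARD('l) then (coord z 1 - coord z (k + 1) + v k \<bullet> v k) / 2 else coord z 1)" for z

  (* If the first m coordinates of w are those of A u, then L w is the orthogonal projection of u
     to the span of the v k. *)
  define L :: "(real, 'l) vec \<Rightarrow> (real, 'n) vec"
    where "L w = inv A (of_coords (\<lambda>k. if k \<le> m then coord w k else 0))" for w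
  define h :: "(real, 'l) vec \<Rightarrow> (real, 'l) vec" where "h w = of_coords (\<lambda>k.
    if k \<le> m then 0 else if k < CARD('l) then v k \<bullet> L w else L w \<bullet> L w)" for w
  have smooth_L: "smooth L"
    unfolding L_def
    by (rule smooth_compose[OF smooth_A(2)], rule smooth_of_coords)
      (intro smooth_if smooth_coord smooth_const)
  have smooth_h: "smooth h"
    unfolding h_def
    by (rule smooth_of_coords) (intro smooth_if smooth_const smooth_inner smooth_L)
  have L_cong: "L w = L w'" if "\<And>k. k \<in> {1..m} \<Longrightarrow> coord w k = coord w' k" for w w'
    unfolding L_def
    by (rule arg_cong[where f = "inv A"], rule vec_eq_coordI) (use that in \<open>auto simp: coord_of_coords\<close>)
  have h_low: "coord (h w) k = 0" if "k \<in> {1..m}" for w k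
    using that m by (simp add: h_def coord_of_coords)
  have "L (w + h w) = L w" "L (w - h w) = L w" for w
    by (rule L_cong; simp add: coord_add coord_diff h_low)+
  moreover have "h w = h w'" if "L w = L w'" for w w'
    unfolding h_def that ..
  ultimately have h_shear: "h (w + h w) = h w" "h (w - h w) = h w" for w
    by blast+
  have \<psi>: "diffeomorphism (\<lambda>z. \<alpha> z - h (\<alpha> z))"
    using diffeomorphism_compose[OF _ diffeomorphism_shear[OF smooth_h h_shear], of \<alpha>]
      diffeomorphism_distance_differences[OF l, of "\<lambda>k. v k \<bullet> v k"]
    unfolding \<alpha>_def by blast

  have "\<alpha> (distance_squared p x) - h (\<alpha> (distance_squared p x)) = ?N (\<phi> x)" for x
  proof (rule vec_eq_coordI)
    define u where "u = x - p 1"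
    define w where "w = \<alpha> (distance_squared p x)"
    define u' where "u' = L w"
    define s where "s = u - u'"
    have D: "coord (distance_squared p x :: (real, 'l) vec) j = (dist (p j) x)\<^sup>2" if "j \<in> {1..CARD('l)}" for j
      using that coord_of_coords[of j "\<lambda>j. (dist (p j) x)\<^sup>2", where 'n = 'l]
      by (simp add: distance_squared_def of_coords_def)
    have D1: "coord (distance_squared p x :: (real, 'l) vec) 1 = u \<bullet> u"
      using l by (simp add: D u_def dist_norm power2_norm_eq_inner norm_minus_commute)
    have Dk: "coord (distance_squared p x :: (real, 'l) vec) (k + 1) = u \<bullet> u - 2 * (v k \<bullet> u) + v k \<bullet> v k"
      if "k < CARD('l)" for k
    proof -
      have "p (k + 1) - x = v k - u"
        by (simp add: v_def u_def)
      then show ?thesis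
        using that by (simp add: D dist_norm power2_norm_eq_inner inner_diff inner_commute)
    qed
    have w_low: "coord w k = v k \<bullet> u" if "k \<in> {1..<CARD('l)}" for k
      using that D1 Dk[of k] by (simp add: w_def \<alpha>_def coord_of_coords)
    have w_top: "coord w CARD('l) = u \<bullet> u"
      using D1 l by (simp add: w_def \<alpha>_def coord_of_coords)
    have Au': "coord (A u') k = (if k \<le> m then v k \<bullet> u else 0)" if "k \<in> {1..CARD('n)}" for k
      using that m by (simp add: u'_def L_def A_inv coord_of_coords w_low)
    have s_orth: "\<forall>k\<in>{1..m}. v k \<bullet> s = 0"
      using A(3)[of _ u'] Au' m by (auto simp: s_def inner_diff_right)
    have As: "coord (A s) k = coord (\<phi> x) k" if "k \<in> {m + 1..CARD('n)}" for k
      using that Au' by (simp add: s_def linear_diff[OF A(1)] coord_diff \<phi>_def u_def)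
    have ss: "s \<bullet> s = (\<Sum>j = m + 1..CARD('n). (coord (\<phi> x) j)\<^sup>2)"
      unfolding parseval[OF s_orth] by (rule sum.cong) (simp_all add: As power2_eq_square)
    have "s \<bullet> u' = 0"
      unfolding parseval[OF s_orth] by (rule sum.neutral) (simp add: Au')
    then have pythagoras: "u \<bullet> u - u' \<bullet> u' = s \<bullet> s"
      by (simp add: s_def inner_diff inner_commute)
    fix k assume k: "k \<in> {1..CARD('l)}"
    consider "k \<le> m" | "m < k" "k < CARD('l)" | "k = CARD('l)"
      using k by fastforce
    then have "coord (w - h w) k = coord (?N (\<phi> x)) k"
    proof cases
      case 1
      then show ?thesis
        using k m w_low A(3)[of k u] by (simp add: coord_diff h_low coord_of_coords \<phi>_def u_def)
    next
      case 2
      (* There is such a k only if m is the dimension, and then the v k span the whole space. *)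
      then have "m = CARD('n)"
        by (auto simp: m_def)
      then have "u = u'"
        using ss by (simp add: s_def)
      then show ?thesis
        using k 2 w_low by (simp add: coord_diff h_def coord_of_coords u'_def)
    next
      case 3
      then show ?thesis
        using k m w_top pythagoras ss by (simp add: coord_diff h_def coord_of_coords u'_def)
    qed
    then show "coord (\<alpha> (distance_squared p x) - h (\<alpha> (distance_squared p x))) k
        = coord (?N (\<phi> x)) k"
      by (simp add: w_def)
  qed
  then show ?thesis
    by (rule A_equivalentI[OF \<phi> \<psi>])
qed

theorem proposition2p1:
  fixes p :: "nat \<Rightarrow> real^'n::{finite,linorder}"
  shows "(2 \<le> CARD('l) \<and> CARD('l) \<le> CARD('n) \<and> general_position CARD('l) p \<longrightarrow>
            A_equivalent
              (distance_squared p :: real^'n::{finite,linorder} \<Rightarrow> real^'l::{finite,linorder})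
              definite_fold) \<and>
         (1 \<le> CARD('n) \<and> CARD('n) < CARD('l) \<and> general_position (CARD('n) + 1) p \<longrightarrow>
            A_equivalent
              (distance_squared p :: real^'n::{finite,linorder} \<Rightarrow> real^'l::{finite,linorder})
              inclusion)"
proof (intro conjI impI; elim conjE)
  assume l: "2 \<le> CARD('l)" "CARD('l) \<le> CARD('n)" and gp: "general_position CARD('l) p"
  then have m: "min CARD('n) (CARD('l) - 1) = CARD('l) - 1" "CARD('l) - 1 + 1 = CARD('l)"
    by auto
  have "(\<lambda>x :: (real, 'n) vec. of_coords (\<lambda>k. if k \<le> CARD('l) - 1 then coord x k
      else if k < CARD('l) then 0 else \<Sum>j = CARD('l)..CARD('n). (coord x j)\<^sup>2) :: (real, 'l) vec)
    = definite_fold"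
    using l by (auto simp: of_coords_def definite_fold_def fun_eq_iff vec_eq_iff)
  with distance_squared_A_equivalent[OF l(1), of p, unfolded m, OF gp]
  show "A_equivalent (distance_squared p :: (real, 'n) vec \<Rightarrow> (real, 'l) vec) definite_fold"
    by simp
next
  assume n: "1 \<le> CARD('n)" "CARD('n) < CARD('l)" and gp: "general_position (CARD('n) + 1) p"
  then have l: "2 \<le> CARD('l)" and m: "min CARD('n) (CARD('l) - 1) = CARD('n)"
    by linarith+
  have "(\<lambda>x :: (real, 'n) vec. of_coords (\<lambda>k. if k \<le> CARD('n) then coord x k
      else if k < CARD('l) then 0 else \<Sum>j = CARD('n) + 1..CARD('n). (coord x j)\<^sup>2) :: (real, 'l) vec)
    = inclusion"
    by (auto simp: of_coords_def inclusion_def fun_eq_iff vec_eq_iff)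
  with distance_squared_A_equivalent[OF l, of p, unfolded m, OF gp]
  show "A_equivalent (distance_squared p :: (real, 'n) vec \<Rightarrow> (real, 'l) vec) inclusion"
    by simp
qed

end
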